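(* Let $K\ge 2$, $d\ge 1$, $L>0$, let $x_1,\dots,x_K\in\mathbb{R}^d$ and $g_1,\dots,g_K\in\mathbb{R}^d$, and let $\Sigma\in\mathbb{R}^{d\times d}$ be a symmetric positive definite matrix. Let $\hat\theta_1,\dots,\hat\theta_K\in\mathbb{R}^d$ be the COCO estimates computed from the raw observations $g_1,\dots,g_K$ at the points $x_1,\dots,x_K$ with constant $L$ and noise covariance $\Sigma$. Then the estimates and the raw observations have the same centroid: $$\frac1K\sum_{i=1}^K\hat\theta_i=\frac1K\sum_{i=1}^K g_i .$$
   Context: Norms and inner products are Euclidean. The COCO estimates $(\hat\theta_1,\dots,\hat\theta_K)$ for the data $(x_i)$, $(g_i)$, $L$, $\Sigma$ are the (unique) solution of the convex optimization problem $$\underset{\theta_1,\dots,\theta_K\in\mathbb{R}^d}{\text{minimize}}\ \frac12\sum_{k=1}^K (g_k-\theta_k)^T\Sigma^{-1}(g_k-\theta_k)\quad\text{subject to}\quad \frac1L\|\theta_m-\theta_l\|^2\le\langle\theta_m-\theta_l,\,x_m-x_l\rangle,\quad 1\le m<l\le K.$$ (When $\Sigma=\sigma^2 I$, this is equivalent to minimizing $\sum_{k}\|g_k-\theta_k\|^2$ under the same constraints.) *)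

theory Defs
  imports "HOL-Analysis.Analysis"
begin

definition sym_pos_def :: "real^'d^'d \<Rightarrow> bool" where
  "sym_pos_def S \<longleftrightarrow> transpose S = S \<and> (\<forall>v. v \<noteq> 0 \<longrightarrow> v \<bullet> (S *v v) > 0)"

(* Families of K points are functions on nat of which only the values at 1, ..., K matter. *)

definition coco_objective ::
    "nat \<Rightarrow> real^'d^'d \<Rightarrow> (nat \<Rightarrow> real^'d) \<Rightarrow> (nat \<Rightarrow> real^'d) \<Rightarrow> real" where
  "coco_objective K S g \<theta> =
     1/2 * (\<Sum>k=1..K. (g k - \<theta> k) \<bullet> (matrix_inv S *v (g k - \<theta> k)))"

definition coco_feasible ::
    "nat \<Rightarrow> real \<Rightarrow> (nat \<Rightarrow> real^'d) \<Rightarrow> (nat \<Rightarrow> real^'d) \<Rightarrow> bool" where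
  "coco_feasible K L x \<theta> \<longleftrightarrow>
     (\<forall>m l. 1 \<le> m \<and> m < l \<and> l \<le> K \<longrightarrow>
        1/L * (norm (\<theta> m - \<theta> l))\<^sup>2 \<le> (\<theta> m - \<theta> l) \<bullet> (x m - x l))"

(* The minimizer is unique only as far as its values at 1, ..., K are concerned, so
   being the COCO estimates is a predicate rather than a function of the data. *)
definition is_coco_estimate ::
    "nat \<Rightarrow> real \<Rightarrow> real^'d^'d \<Rightarrow> (nat \<Rightarrow> real^'d) \<Rightarrow> (nat \<Rightarrow> real^'d) \<Rightarrow> (nat \<Rightarrow> real^'d) \<Rightarrow> bool" where
  "is_coco_estimate K L S x g \<theta> \<longleftrightarrow>
     is_arg_min (coco_objective K S g) (coco_feasible K L x) \<theta>"

end

theory Submission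
  imports Defs
begin

text \<open>The constraints only involve differences of the \<open>\<theta> k\<close>, so translating all of them by a
  common vector preserves feasibility. Translating by the mean residual \<open>c\<close> changes the objective
  by \<open>- K / 2\<close> times the squared norm of \<open>c\<close> in the metric of the inverse covariance; minimality
  forces \<open>c = 0\<close>.\<close>

text \<open>A vector in the kernel of \<open>S\<close> has zero quadratic form, so definiteness
  leaves only the trivial kernel.\<close>

lemma sym_pos_def_invertible:
  fixes S :: "real^'d^'d"
  assumes "sym_pos_def S"
  shows "invertible S"
proof -
  have "v = 0" if "S *v v = 0" for v
    using assms that unfolding sym_pos_def_def by (metis inner_zero_right less_irrefl)
  then show ?thesis
    by (simp add: invertible_left_inverse matrix_left_invertible_ker)
qed

lemma matrix_inv_mult:
  fixes A :: "'a::semiring_1^'n^'m"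
  assumes "invertible A"
  shows "A ** matrix_inv A = mat 1" and "matrix_inv A ** A = mat 1"
proof -
  have "A ** matrix_inv A = mat 1 \<and> matrix_inv A ** A = mat 1"
    using assms unfolding invertible_def matrix_inv_def by (rule someI_ex)
  then show "A ** matrix_inv A = mat 1" and "matrix_inv A ** A = mat 1"
    by simp_all
qed

text \<open>Transposing the inverse of the symmetric \<open>S\<close> gives a right inverse of
  \<open>S\<close>, which must equal its left inverse. For positivity, with \<open>w\<close> the
  image of \<open>v\<close> under the inverse, the form of the inverse at \<open>v\<close> is the
  form of \<open>S\<close> at \<open>w\<close>.\<close>

lemma sym_pos_def_matrix_inv:
  fixes S :: "real^'d^'d"
  assumes "sym_pos_def S"
  shows "sym_pos_def (matrix_inv S)"
proof -
  have inv: "invertible S"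
    by (rule sym_pos_def_invertible[OF assms])
  have S_inv: "S *v (matrix_inv S *v v) = v" for v
    by (simp add: matrix_vector_mul_assoc matrix_inv_mult(1)[OF inv])
  have "transpose S ** transpose (matrix_inv S) = mat 1"
    by (metis matrix_inv_mult(2)[OF inv] matrix_transpose_mul transpose_mat)
  then have "S ** transpose (matrix_inv S) = mat 1"
    using assms by (simp add: sym_pos_def_def)
  then have sym: "transpose (matrix_inv S) = matrix_inv S"
    by (metis matrix_inv_mult(2)[OF inv] matrix_mul_assoc matrix_mul_lid matrix_mul_rid)
  have "v \<bullet> (matrix_inv S *v v) > 0" if "v \<noteq> 0" for v
  proof -
    let ?w = "matrix_inv S *v v"
    have "?w \<noteq> 0"
      using S_inv[of v] that by auto
    then have "?w \<bullet> (S *v ?w) > 0"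
      using assms by (simp add: sym_pos_def_def)
    then show ?thesis
      by (simp add: S_inv inner_commute)
  qed
  with sym show ?thesis
    by (simp add: sym_pos_def_def)
qed

text \<open>Parallel axis identity: as the \<open>r k\<close> sum to \<open>card I\<close> times
  \<open>c\<close>, the cross terms contribute minus twice the last term, and the constant terms
  give it back once.\<close>

lemma sum_quadratic_form_centered:
  fixes A :: "real^'d^'d" and r :: "'i \<Rightarrow> real^'d"
  assumes sym: "transpose A = A" and c: "(\<Sum>k\<in>I. r k) = real (card I) *\<^sub>R c"
  shows "(\<Sum>k\<in>I. (r k - c) \<bullet> (A *v (r k - c))) =
    (\<Sum>k\<in>I. r k \<bullet> (A *v r k)) - real (card I) * (c \<bullet> (A *v c))"
proof -
  \<comment> \<open>Self-adjointness of \<open>A\<close> merges the two cross terms of the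
    expansion.\<close>
  have adj: "u \<bullet> (A *v v) = v \<bullet> (A *v u)" for u v
    by (metis dot_lmul_matrix inner_commute sym transpose_matrix_vector)
  have "(r k - c) \<bullet> (A *v (r k - c)) =
      r k \<bullet> (A *v r k) - 2 * (r k \<bullet> (A *v c)) + c \<bullet> (A *v c)" for k
    using adj[of c "r k"]
    by (simp add: matrix_vector_mult_diff_distrib inner_diff_left inner_diff_right)
  then have "(\<Sum>k\<in>I. (r k - c) \<bullet> (A *v (r k - c))) =
      (\<Sum>k\<in>I. r k \<bullet> (A *v r k)) - 2 * ((\<Sum>k\<in>I. r k) \<bullet> (A *v c))
        + real (card I) * (c \<bullet> (A *v c))"
    by (simp add: sum.distrib sum_subtractf inner_sum_left flip: sum_distrib_left)
  then show ?thesis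
    by (simp add: c)
qed

lemma coco_feasible_translate:
  "coco_feasible K L x (\<lambda>k. \<theta> k + c) \<longleftrightarrow> coco_feasible K L x \<theta>"
  by (simp add: coco_feasible_def)

theorem theorem4p1:
  fixes K :: nat and L :: real and S :: "real^'d^'d"
    and x g \<theta> :: "nat \<Rightarrow> real^'d"
  assumes "K \<ge> 2" and "L > 0"
    and "sym_pos_def S"
    and "is_coco_estimate K L S x g \<theta>"
  shows "(1 / real K) *\<^sub>R (\<Sum>i=1..K. \<theta> i) = (1 / real K) *\<^sub>R (\<Sum>i=1..K. g i)"
proof -
  let ?A = "matrix_inv S"
  \<comment> \<open>Of all common translations, the one by the mean residual lowers the objective
    most.\<close>
  define c where "c = (1 / real K) *\<^sub>R (\<Sum>k=1..K. g k - \<theta> k)"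
  have A: "sym_pos_def ?A"
    by (rule sym_pos_def_matrix_inv[OF assms(3)])
  have "coco_feasible K L x (\<lambda>k. \<theta> k + c)"
    using assms(4) by (simp add: coco_feasible_translate is_coco_estimate_def is_arg_min_def)
  then have min: "coco_objective K S g \<theta> \<le> coco_objective K S g (\<lambda>k. \<theta> k + c)"
    using assms(4) by (auto simp: is_coco_estimate_def is_arg_min_linorder)
  have "(\<Sum>k=1..K. g k - \<theta> k) = real (card {1..K}) *\<^sub>R c"
    using assms(1) by (simp add: c_def)
  \<comment> \<open>The translated residual \<open>g k - (\<theta> k + c)\<close> is regrouped as
    \<open>(g k - \<theta> k) - c\<close> to fit the centering identity.\<close>
  then have "coco_objective K S g (\<lambda>k. \<theta> k + c) =
      coco_objective K S g \<theta> - real K / 2 * (c \<bullet> (?A *v c))"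
    using sum_quadratic_form_centered[of ?A "\<lambda>k. g k - \<theta> k" "{1..K}" c] A
    by (simp add: coco_objective_def sym_pos_def_def diff_diff_eq[symmetric] right_diff_distrib)
  with min have "real K * (c \<bullet> (?A *v c)) \<le> 0"
    by simp
  then have "c \<bullet> (?A *v c) \<le> 0"
    using assms(1) by (simp add: mult_le_0_iff)
  then have "c = 0"
    using A by (auto simp: sym_pos_def_def simp flip: not_less)
  then show ?thesis
    by (auto simp: c_def sum_subtractf)
qed

end
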